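(* Let $S=\mathbb{Z}\cup\{\top,\bot\}$, let $c:2^S\to 2^S$ be complementation $c(A)=S\setminus A$, and let $p,q:2^S\to 2^S$ be the maps defined in the context. Then $p$ and $q$ are closure operators on $S$ with $p\circ q=q\circ p$, and there exists a subset $A\subseteq S$ such that repeatedly applying the operator $cpcpcqcq$ to $A$ results in infinitely many distinct sets; that is, the family $\{(cpcpcqcq)^n(A) : n\ge 1\}$ of subsets of $S$ is infinite.
   Context: A closure operator on a set $X$ is a map $k:2^X\to 2^X$ such that for all $A,B\subseteq X$: (1) $A\subseteq k(A)$; (2) $A\subseteq B$ implies $k(A)\subseteq k(B)$; (3) $k(k(A))=k(A)$. Concatenation of operators denotes composition, with the rightmost operator applied first, and $(cpcpcqcq)^n$ is the $n$-fold composition of $cpcpcqcq$ with itself. Let $\top,\bot$ be two distinct elements not in $\mathbb{Z}$. Let $\mathrm{Even}$ be the set of even integers and $\mathrm{Odd}=\mathbb{Z}\setminus\mathrm{Even}$. Define maps $p_{ij},q_{ij}:2^{\mathbb{Z}}\to 2^{\mathbb{Z}}$ for $i,j\in\{0,1\}$ as follows, for $A\subseteq\mathbb{Z}$: (i) $p_{00}(A)=q_{00}(A)=A$. (ii) $p_{11}(A)=q_{11}(A)=\mathbb{Z}$. (iii) $p_{10}(\emptyset)=\emptyset$; for each $n\in\mathbb{Z}$, $p_{10}(\{2n-1\})=p_{10}(\{2n\})=p_{10}(\{2n-1,2n\})=\{2n-1,2n\}$; and $p_{10}(A)=\mathbb{Z}$ if there is no $n\in\mathbb{Z}$ with $A\subseteq\{2n-1,2n\}$.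 Likewise $q_{10}(\emptyset)=\emptyset$; for each $n\in\mathbb{Z}$, $q_{10}(\{2n\})=q_{10}(\{2n+1\})=q_{10}(\{2n,2n+1\})=\{2n,2n+1\}$; and $q_{10}(A)=\mathbb{Z}$ if there is no $n\in\mathbb{Z}$ with $A\subseteq\{2n,2n+1\}$. (iv) $p_{01}(A)=A\cup\mathrm{Odd}$ and $q_{01}(A)=A\cup\mathrm{Even}$. For $A\subseteq S$ define $p(A)=p_{00}(A)$ if $A\cap\{\top,\bot\}=\emptyset$; $p(A)=p_{10}(A\cap\mathbb{Z})\cup\{\top\}$ if $A\cap\{\top,\bot\}=\{\top\}$; $p(A)=p_{01}(A\cap\mathbb{Z})\cup\{\bot\}$ if $A\cap\{\top,\bot\}=\{\bot\}$; $p(A)=p_{11}(A\cap\mathbb{Z})\cup\{\top,\bot\}$ if $A\cap\{\top,\bot\}=\{\top,\bot\}$. Define $q(A)$ in the same way, with each $p_{ij}$ replaced by $q_{ij}$. *)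

theory Defs
  imports Main
begin

(* The ground set X is the whole type 'a. *)
definition closure_operator :: "('a set \<Rightarrow> 'a set) \<Rightarrow> bool" where
  "closure_operator k \<longleftrightarrow>
     (\<forall>A. A \<subseteq> k A) \<and>
     (\<forall>A B. A \<subseteq> B \<longrightarrow> k A \<subseteq> k B) \<and>
     (\<forall>A. k (k A) = k A)"

(* The set S, i.e. the integers with two further points, is UNIV :: point set. *)
datatype point = Num int | Top | Bot

definition compl_op :: "point set \<Rightarrow> point set" where
  "compl_op A = UNIV - A"

definition p00 :: "int set \<Rightarrow> int set" where "p00 A = A"
definition q00 :: "int set \<Rightarrow> int set" where "q00 A = A"

definition p11 :: "int set \<Rightarrow> int set" where "p11 A = UNIV"
definition q11 :: "int set \<Rightarrow> int set" where "q11 A = UNIV"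

(* The description operators below are only used where A is nonempty and
   contained in some block, and then that block is unique; see p10_block, q10_block. *)
definition p10 :: "int set \<Rightarrow> int set" where
  "p10 A =
     (if A = {} then {}
      else if \<exists>n. A \<subseteq> {2*n - 1, 2*n} then
        (let n = THE n. A \<subseteq> {2*n - 1, 2*n} in {2*n - 1, 2*n})
      else UNIV)"

definition q10 :: "int set \<Rightarrow> int set" where
  "q10 A =
     (if A = {} then {}
      else if \<exists>n. A \<subseteq> {2*n, 2*n + 1} then
        (let n = THE n. A \<subseteq> {2*n, 2*n + 1} in {2*n, 2*n + 1})
      else UNIV)"

definition p01 :: "int set \<Rightarrow> int set" where "p01 A = A \<union> {n. odd n}"
definition q01 :: "int set \<Rightarrow> int set" where "q01 A = A \<union> {n. even n}"

(* Num -` A is the integer part of A. The first index of f_ij records whether Top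
   belongs to A, the second whether Bot does. *)
definition glue ::
  "(int set \<Rightarrow> int set) \<Rightarrow> (int set \<Rightarrow> int set) \<Rightarrow> (int set \<Rightarrow> int set) \<Rightarrow> (int set \<Rightarrow> int set)
     \<Rightarrow> point set \<Rightarrow> point set" where
  "glue f00 f10 f01 f11 A =
     (if A \<inter> {Top, Bot} = {} then Num ` f00 (Num -` A)
      else if A \<inter> {Top, Bot} = {Top} then Num ` f10 (Num -` A) \<union> {Top}
      else if A \<inter> {Top, Bot} = {Bot} then Num ` f01 (Num -` A) \<union> {Bot}
      else Num ` f11 (Num -` A) \<union> {Top, Bot})"

definition p_op :: "point set \<Rightarrow> point set" where
  "p_op = glue p00 p10 p01 p11"

definition q_op :: "point set \<Rightarrow> point set" where
  "q_op = glue q00 q10 q01 q11"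

lemma p10_empty: "p10 {} = {}"
  by (simp add: p10_def)

lemma p10_block:
  assumes "A \<noteq> {}" "A \<subseteq> {2*n - 1, 2*n}"
  shows "p10 A = {2*n - 1, 2*n}"
proof -
  have "m = n" if "A \<subseteq> {2*m - 1, 2*m}" for m
  proof -
    obtain x where "x \<in> A" using assms(1) by blast
    then have "x = 2*m - 1 \<or> x = 2*m" "x = 2*n - 1 \<or> x = 2*n"
      using that assms(2) by auto
    then show ?thesis by presburger
  qed
  then have "(THE n. A \<subseteq> {2*n - 1, 2*n}) = n"
    using assms(2) by (intro the_equality)
  then show ?thesis
    using assms by (auto simp: p10_def Let_def)
qed

lemma p10_other: "\<nexists>n. A \<subseteq> {2*n - 1, 2*n} \<Longrightarrow> p10 A = UNIV"
  by (auto simp: p10_def)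

lemma q10_empty: "q10 {} = {}"
  by (simp add: q10_def)

lemma q10_block:
  assumes "A \<noteq> {}" "A \<subseteq> {2*n, 2*n + 1}"
  shows "q10 A = {2*n, 2*n + 1}"
proof -
  have "m = n" if "A \<subseteq> {2*m, 2*m + 1}" for m
  proof -
    obtain x where "x \<in> A" using assms(1) by blast
    then have "x = 2*m \<or> x = 2*m + 1" "x = 2*n \<or> x = 2*n + 1"
      using that assms(2) by auto
    then show ?thesis by presburger
  qed
  then have "(THE n. A \<subseteq> {2*n, 2*n + 1}) = n"
    using assms(2) by (intro the_equality)
  then show ?thesis
    using assms by (auto simp: q10_def Let_def)
qed

lemma q10_other: "\<nexists>n. A \<subseteq> {2*n, 2*n + 1} \<Longrightarrow> q10 A = UNIV"
  by (auto simp: q10_def)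

end

theory Submission
  imports Defs
begin

text \<open>
  Started at \<open>{Top, 2n}\<close>, the operator \<open>cqcq\<close> closes up the \<open>q\<close>-block \<open>{2n, 2n+1}\<close> and then
  removes its even element, giving \<open>{Top, 2n+1}\<close>; likewise \<open>cpcp\<close> moves on to \<open>{Top, 2n+2}\<close>.
  The closures commute because every \<open>p\<close>-block meets two \<open>q\<close>-blocks and vice versa, and
  because adding all odd and all even numbers gives everything.
\<close>

text \<open>For nonempty \<open>A\<close>, \<open>p10 A\<close> is the intersection of all blocks
  containing \<open>A\<close>; the value \<open>UNIV\<close> is the empty intersection. This form
  avoids the definite description and the case split.\<close>

lemma mem_p10_iff:
  "x \<in> p10 A \<longleftrightarrow> A \<noteq> {} \<and> (\<forall>n. A \<subseteq> {2*n - 1, 2*n} \<longrightarrow> x \<in> {2*n - 1, 2*n})"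
proof (cases "A \<noteq> {} \<and> (\<exists>n. A \<subseteq> {2*n - 1, 2*n})")
  case True
  then obtain n where n: "A \<noteq> {}" "A \<subseteq> {2*n - 1, 2*n}" by blast
  have "p10 A = {2*m - 1, 2*m}" if "A \<subseteq> {2*m - 1, 2*m}" for m
    using p10_block[OF n(1) that] .
  with n show ?thesis by blast
qed (auto simp: p10_empty p10_other)

lemma mem_q10_iff:
  "x \<in> q10 A \<longleftrightarrow> A \<noteq> {} \<and> (\<forall>n. A \<subseteq> {2*n, 2*n + 1} \<longrightarrow> x \<in> {2*n, 2*n + 1})"
proof (cases "A \<noteq> {} \<and> (\<exists>n. A \<subseteq> {2*n, 2*n + 1})")
  case True
  then obtain n where n: "A \<noteq> {}" "A \<subseteq> {2*n, 2*n + 1}" by blast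
  have "q10 A = {2*m, 2*m + 1}" if "A \<subseteq> {2*m, 2*m + 1}" for m
    using q10_block[OF n(1) that] .
  with n show ?thesis by blast
qed (auto simp: q10_empty q10_other)

text \<open>Intersecting the members of a family \<open>B\<close> that contain \<open>A\<close> is a
  closure, because \<open>A\<close> and \<open>k A\<close> lie in the same members. The convention
  that the empty set stays empty preserves this.\<close>

lemma closure_operator_blocksI:
  assumes k: "\<And>x A. x \<in> k A \<longleftrightarrow> A \<noteq> {} \<and> (\<forall>n. A \<subseteq> B n \<longrightarrow> x \<in> B n)"
  shows "closure_operator k"
  unfolding closure_operator_def
proof (intro conjI allI impI)
  show ext: "A \<subseteq> k A" for A
    by (auto simp only: k)
  show "k A \<subseteq> k C" if "A \<subseteq> C" for A C
  proof
    fix x assume "x \<in> k A"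
    then have "A \<noteq> {}" "\<And>n. A \<subseteq> B n \<Longrightarrow> x \<in> B n"
      unfolding k by auto
    with that have "C \<noteq> {}" "\<And>n. C \<subseteq> B n \<Longrightarrow> x \<in> B n"
      by (blast, metis order_trans)
    then show "x \<in> k C" unfolding k by simp
  qed
  show "k (k A) = k A" for A
  proof
    show "k (k A) \<subseteq> k A"
    proof
      fix x assume "x \<in> k (k A)"
      then have x: "k A \<noteq> {}" "\<And>n. k A \<subseteq> B n \<Longrightarrow> x \<in> B n"
        unfolding k[of _ "k A"] by auto
      have sub: "k A \<subseteq> B n" if "A \<subseteq> B n" for n
        using that by (auto simp only: k)
      have "A \<noteq> {}" using x(1) by (auto simp only: k)
      moreover have "x \<in> B n" if "A \<subseteq> B n" for n
        using x(2) sub that by simp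
      ultimately show "x \<in> k A" unfolding k by simp
    qed
  qed (rule ext)
qed

lemma closure_operator_p10: "closure_operator p10"
  by (rule closure_operator_blocksI) (rule mem_p10_iff)

lemma closure_operator_q10: "closure_operator q10"
  by (rule closure_operator_blocksI) (rule mem_q10_iff)

text \<open>\<open>q10 A\<close> contains a full \<open>q\<close>-block, and its two elements lie in
  different \<open>p\<close>-blocks, so no \<open>p\<close>-block contains
  \<open>q10 A\<close>.\<close>

lemma p10_q10:
  assumes "A \<noteq> {}"
  shows "p10 (q10 A) = UNIV"
proof (rule p10_other, rule notI)
  assume "\<exists>n. q10 A \<subseteq> {2*n - 1, 2*n}"
  then obtain a n where a: "a \<in> A" and n: "q10 A \<subseteq> {2*n - 1, 2*n}" using assms by blast
  define m where "m = a div 2"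
  have am: "{a} \<subseteq> {2*m, 2*m + 1}" unfolding m_def by simp presburger
  \<comment> \<open>Monotonicity reduces the claim to a singleton, whose closure is exactly block
    number \<open>m\<close>.\<close>
  have "q10 {a} \<subseteq> q10 A"
    using a closure_operator_q10 by (simp add: closure_operator_def)
  with n q10_block[OF _ am] have "{2*m, 2*m + 1} \<subseteq> {2*n - 1, 2*n}" by blast
  then show False by simp presburger
qed

lemma q10_p10:
  assumes "A \<noteq> {}"
  shows "q10 (p10 A) = UNIV"
proof (rule q10_other, rule notI)
  assume "\<exists>n. p10 A \<subseteq> {2*n, 2*n + 1}"
  then obtain a n where a: "a \<in> A" and n: "p10 A \<subseteq> {2*n, 2*n + 1}" using assms by blast
  \<comment> \<open>The shift by one sends both \<open>2*m - 1\<close> and \<open>2*m\<close> to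
    \<open>m\<close>, the index of the \<open>p\<close>-block of \<open>a\<close>.\<close>
  define m where "m = (a + 1) div 2"
  have am: "{a} \<subseteq> {2*m - 1, 2*m}" unfolding m_def by simp presburger
  have "p10 {a} \<subseteq> p10 A"
    using a closure_operator_p10 by (simp add: closure_operator_def)
  with n p10_block[OF _ am] have "{2*m - 1, 2*m} \<subseteq> {2*n, 2*n + 1}" by blast
  then show False by simp presburger
qed

lemma p10_q10_commute: "p10 (q10 A) = q10 (p10 A)"
  by (cases "A = {}") (simp_all add: p10_empty q10_empty p10_q10 q10_p10)

lemma glue_eq:
  "glue f00 f10 f01 f11 A =
    Num ` (if Top \<in> A then if Bot \<in> A then f11 (Num -` A) else f10 (Num -` A)
           else if Bot \<in> A then f01 (Num -` A) else f00 (Num -` A)) \<union> (A \<inter> {Top, Bot})"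
  by (auto simp: glue_def)

lemma mem_glue [simp]:
  "Top \<in> glue f00 f10 f01 f11 A \<longleftrightarrow> Top \<in> A"
  "Bot \<in> glue f00 f10 f01 f11 A \<longleftrightarrow> Bot \<in> A"
  by (auto simp: glue_eq)

text \<open>Glued operators keep \<open>Top\<close> and \<open>Bot\<close> as they are, so along a
  composition of them the same index applies throughout, and only integer parts need
  computing.\<close>

lemma vimage_glue:
  "Num -` glue f00 f10 f01 f11 A =
    (if Top \<in> A then if Bot \<in> A then f11 (Num -` A) else f10 (Num -` A)
     else if Bot \<in> A then f01 (Num -` A) else f00 (Num -` A))"
  by (auto simp: glue_eq)

lemma point_set_eqI:
  assumes "Num -` A = Num -` B" "Top \<in> A \<longleftrightarrow> Top \<in> B" "Bot \<in> A \<longleftrightarrow> Bot \<in> B"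
  shows "A = B"
proof (rule set_eqI)
  show "x \<in> A \<longleftrightarrow> x \<in> B" for x using assms by (cases x) auto
qed

lemma point_subsetI:
  assumes "Num -` A \<subseteq> Num -` B" "Top \<in> A \<Longrightarrow> Top \<in> B" "Bot \<in> A \<Longrightarrow> Bot \<in> B"
  shows "A \<subseteq> B"
proof
  show "x \<in> A \<Longrightarrow> x \<in> B" for x using assms by (cases x) auto
qed

text \<open>Extensivity and idempotence hold index by index. Enlarging a set can add
  \<open>Top\<close> or \<open>Bot\<close> and so switch the component; the inclusions
  \<open>le\<close> make the components increase with the index.\<close>

lemma closure_operator_glue:
  assumes cl: "closure_operator f00" "closure_operator f10" "closure_operator f01"
      "closure_operator f11"
    and le: "\<And>A. f00 A \<subseteq> f10 A" "\<And>A. f00 A \<subseteq> f01 A" "\<And>A. f10 A \<subseteq> f11 A" "\<And>A. f01 A \<subseteq> f11 A"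
  shows "closure_operator (glue f00 f10 f01 f11)"
proof -
  let ?k = "glue f00 f10 f01 f11"
  note ext = cl[unfolded closure_operator_def, THEN conjunct1, rule_format]
  note mono = cl[unfolded closure_operator_def, THEN conjunct2, THEN conjunct1, rule_format]
  note idem = cl[unfolded closure_operator_def, THEN conjunct2, THEN conjunct2, rule_format]
  have "A \<subseteq> ?k A" for A
    by (rule point_subsetI) (simp_all add: vimage_glue ext)
  moreover have "?k A \<subseteq> ?k B" if "A \<subseteq> B" for A B
  proof (rule point_subsetI)
    have AB: "Num -` A \<subseteq> Num -` B" using that by blast
    have TB: "Top \<in> A \<Longrightarrow> Top \<in> B" "Bot \<in> A \<Longrightarrow> Bot \<in> B" using that by auto
    show "Num -` ?k A \<subseteq> Num -` ?k B"
      \<comment> \<open>First enlarge the integer part within the component selected by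
        \<open>A\<close>, then pass to the component selected by \<open>B\<close>.\<close>
      using mono[OF AB] le[of "Num -` B"] TB by (auto simp: vimage_glue)
  qed (use that in auto)
  moreover have "?k (?k A) = ?k A" for A
    by (rule point_set_eqI) (simp_all add: vimage_glue idem)
  ultimately show ?thesis by (simp add: closure_operator_def)
qed

lemma closure_operator_p_op: "closure_operator p_op"
  unfolding p_op_def
proof (rule closure_operator_glue)
  show "p00 A \<subseteq> p10 A" for A
    using closure_operator_p10 by (simp add: closure_operator_def p00_def)
  show "closure_operator p10" by (rule closure_operator_p10)
qed (auto simp: closure_operator_def p00_def p01_def p11_def)

lemma closure_operator_q_op: "closure_operator q_op"
  unfolding q_op_def
proof (rule closure_operator_glue)
  show "q00 A \<subseteq> q10 A" for A
    using closure_operator_q10 by (simp add: closure_operator_def q00_def)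
  show "closure_operator q10" by (rule closure_operator_q10)
qed (auto simp: closure_operator_def q00_def q01_def q11_def)

lemma p01_q01_commute: "p01 (q01 A) = q01 (p01 A)"
  by (simp add: p01_def q01_def Un_ac)

text \<open>Both operators select the same index, so it suffices that the components commute for
  each index.\<close>

lemma p_op_q_op_commute: "p_op (q_op A) = q_op (p_op A)"
  by (rule point_set_eqI)
    (simp_all add: p_op_def q_op_def vimage_glue p10_q10_commute p01_q01_commute
      p00_def p11_def q00_def q11_def)

lemma vimage_Num_simps [simp]:
  "Num -` insert Top A = Num -` A"
  "Num -` insert Bot A = Num -` A"
  "Num -` insert (Num x) A = insert x (Num -` A)"
  "Num -` compl_op A = - (Num -` A)"
  by (auto simp: compl_op_def)

lemma mem_compl_op [simp]: "x \<in> compl_op A \<longleftrightarrow> x \<notin> A"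
  by (simp add: compl_op_def)

lemma compl_op_compl_op [simp]: "compl_op (compl_op A) = A"
  by (auto simp: compl_op_def)

text \<open>Complementation exchanges the presence of \<open>Top\<close> for that of
  \<open>Bot\<close>, so the first \<open>q_op\<close> acts through \<open>q10\<close> and the
  second through \<open>q01\<close>.\<close>

lemma cqcq_step:
  "compl_op (q_op (compl_op (q_op {Top, Num (2*n)}))) = {Top, Num (2*n + 1)}"
proof -
  have 1: "q_op {Top, Num (2*n)} = {Top, Num (2*n), Num (2*n + 1)}"
    by (rule point_set_eqI) (simp_all add: q_op_def vimage_glue q10_block[of "{2*n}" n])
  \<comment> \<open>Adding the even numbers restores \<open>2*n\<close>, so only the odd element of
    the block is still missing.\<close>
  have "- {2*n, 2*n + 1} \<union> {k. even k} = - {2*n + 1}"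
    by auto
  then have 2: "q_op (compl_op {Top, Num (2*n), Num (2*n + 1)}) = compl_op {Top, Num (2*n + 1)}"
    by (intro point_set_eqI) (simp_all add: q_op_def vimage_glue q01_def)
  show ?thesis by (simp only: 1 2 compl_op_compl_op)
qed

lemma cpcp_step:
  "compl_op (p_op (compl_op (p_op {Top, Num (2*n - 1)}))) = {Top, Num (2*n)}"
proof -
  have 1: "p_op {Top, Num (2*n - 1)} = {Top, Num (2*n - 1), Num (2*n)}"
    by (rule point_set_eqI) (simp_all add: p_op_def vimage_glue p10_block[of "{2*n - 1}" n])
  have "- {2*n - 1, 2*n} \<union> {k. odd k} = - {2*n}"
    by auto
  then have 2: "p_op (compl_op {Top, Num (2*n - 1), Num (2*n)}) = compl_op {Top, Num (2*n)}"
    by (intro point_set_eqI) (simp_all add: p_op_def vimage_glue p01_def)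
  show ?thesis by (simp only: 1 2 compl_op_compl_op)
qed

lemma funpow_orbit:
  "((compl_op \<circ> p_op \<circ> compl_op \<circ> p_op \<circ> compl_op \<circ> q_op \<circ> compl_op \<circ> q_op) ^^ n) {Top, Num 0}
    = {Top, Num (2 * int n)}"
proof (induction n)
  case (Suc n)
  then show ?case
    \<comment> \<open>The index \<open>int n + 1\<close> fits because
      \<open>2*(n + 1) - 1 = 2*n + 1\<close> is where the \<open>q\<close> step ends.\<close>
    using cqcq_step[of "int n"] cpcp_step[of "int n + 1"] by (simp add: algebra_simps)
qed simp

theorem theorem8:
  shows "closure_operator p_op \<and> closure_operator q_op \<and>
    p_op \<circ> q_op = q_op \<circ> p_op \<and>
    (\<exists>A :: point set. infinite
      {((compl_op \<circ> p_op \<circ> compl_op \<circ> p_op \<circ> compl_op \<circ> q_op \<circ> compl_op \<circ> q_op) ^^ n) A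
        | n :: nat. n \<ge> 1})"
proof (intro conjI exI)
  show "p_op \<circ> q_op = q_op \<circ> p_op"
    by (simp add: fun_eq_iff p_op_q_op_commute)
  \<comment> \<open>The orbit of \<open>{Top, Num 0}\<close> never repeats, so its tail from
    \<open>n = 1\<close> on is infinite.\<close>
  have "inj (\<lambda>n::nat. {Top, Num (2 * int n)})"
    by (auto simp: inj_def doubleton_eq_iff)
  then have "infinite ((\<lambda>n::nat. {Top, Num (2 * int n)}) ` {1..})"
    by (meson finite_imageD infinite_Ici inj_on_subset subset_UNIV)
  also have "(\<lambda>n::nat. {Top, Num (2 * int n)}) ` {1..} =
      {((compl_op \<circ> p_op \<circ> compl_op \<circ> p_op \<circ> compl_op \<circ> q_op \<circ> compl_op \<circ> q_op) ^^ n)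
        {Top, Num 0} | n :: nat. n \<ge> 1}"
    unfolding funpow_orbit by auto
  finally show "infinite \<dots>" .
qed (fact closure_operator_p_op closure_operator_q_op)+

end
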